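(* Let $K$ be a field, let $x_1,\dots,x_n\in K$ and $z_1,\dots,z_n\in K^\times$, and let $S_1,\dots,S_n\subseteq \mathrm{S}_{\mathrm{val}}(K)$ be sets of (equivalence classes of) valuations on $K$, not necessarily disjoint. Assume: (U) there exists a nonconstant monic polynomial $f\in K[X]$ such that for every $v\in S_1\cup\dots\cup S_n$, $f$ has coefficients in the valuation ring of $v$ and the reduction of $f$ has no zero in the residue field of $v$; (T) each $S_i$ is closed in the Hochster dual of the Zariski topology on $\mathrm{S}_{\mathrm{val}}(K)$; (I) for any $i,j$ and any $w\in S_i\cap S_j$, we have $w(x_i-x_j)\geq w(z_i)=w(z_j)$. Then there exists $x\in K$ with $$v(x-x_i)\geq v(z_i)\quad\text{for all } v\in S_i,\ \text{for } i=1,\dots,n.$$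
   Context: "Valuation" means Krull valuation (arbitrary ordered abelian value group, written additively; the trivial valuation, with valuation ring and residue field $K$, is allowed), with $v(0)=\infty$. $\mathrm{S}_{\mathrm{val}}(K)$ is the set of equivalence classes of valuations on $K$. The Zariski topology on $\mathrm{S}_{\mathrm{val}}(K)$ has as subbasis of open sets the sets $\{v: v(x)\ge 0\}$, $x\in K$. Its Hochster dual is the topology having as a basis of closed sets the quasi-compact Zariski-open sets; equivalently, it is the topology with subbasis of open sets $\{v\in \mathrm{S}_{\mathrm{val}}(K): v(x)>0\}$, $x\in K$. *)

theory Defs
  imports
    "HOL-Algebra.QuotRing"
    "HOL-Algebra.Polynomials"
    "HOL-Analysis.Abstract_Topology"
    "HOL-Computational_Algebra.Polynomial"
begin

section \<open>Krull valuations\<close>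

text \<open>
  Ordered abelian groups are carrier-based, so that valuations with different value groups
  can be members of one set. They use the multiplicative notation of \<^locale>\<open>comm_group\<close>:
  the product of \<open>G\<close> is the addition of values, and \<open>\<one>\<^bsub>G\<^esub>\<close> is the value \<open>0\<close>.
\<close>

locale ordered_comm_group = comm_group G for G :: "('g, 'm) monoid_scheme" (structure) +
  fixes le :: "'g rel"
  assumes linear_order: "linear_order_on (carrier G) le"
    and translation: "\<lbrakk>\<alpha> \<in> carrier G; \<beta> \<in> carrier G; \<gamma> \<in> carrier G; (\<alpha>, \<beta>) \<in> le\<rbrakk>
                        \<Longrightarrow> (\<alpha> \<otimes> \<gamma>, \<beta> \<otimes> \<gamma>) \<in> le"

text \<open>\<^const>\<open>None\<close> is the value \<open>\<infinity>\<close>.\<close>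

record ('a, 'g) valuation =
  value_group :: "'g monoid"
  value_le :: "'g rel"
  val :: "'a \<Rightarrow> 'g option"

definition vplus :: "('a, 'g) valuation \<Rightarrow> 'g option \<Rightarrow> 'g option \<Rightarrow> 'g option" where
  "vplus v a b = (case (a, b) of
      (Some \<alpha>, Some \<beta>) \<Rightarrow> Some (\<alpha> \<otimes>\<^bsub>value_group v\<^esub> \<beta>)
    | _ \<Rightarrow> None)"

definition vle :: "('a, 'g) valuation \<Rightarrow> 'g option \<Rightarrow> 'g option \<Rightarrow> bool" where
  "vle v a b = (case (a, b) of
      (_, None) \<Rightarrow> True
    | (None, Some \<beta>) \<Rightarrow> False
    | (Some \<alpha>, Some \<beta>) \<Rightarrow> (\<alpha>, \<beta>) \<in> value_le v)"

definition vless :: "('a, 'g) valuation \<Rightarrow> 'g option \<Rightarrow> 'g option \<Rightarrow> bool" where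
  "vless v a b \<longleftrightarrow> vle v a b \<and> a \<noteq> b"

definition vzero :: "('a, 'g) valuation \<Rightarrow> 'g option" where
  "vzero v = Some \<one>\<^bsub>value_group v\<^esub>"

text \<open>
  The value group is exactly the set of values of nonzero elements (\<open>val_range\<close>).
  In \<open>val_add\<close>, the disjunction says \<open>min (v x) (v y) \<le> v (x + y)\<close>.
\<close>

locale krull_valuation =
  ordered_comm_group "value_group v" "value_le v" for v :: "('a::field, 'g) valuation" +
  assumes val_range: "range (val v) = insert None (Some ` carrier (value_group v))"
    and val_eq_infinity: "val v x = None \<longleftrightarrow> x = 0"
    and val_mult: "val v (x * y) = vplus v (val v x) (val v y)"
    and val_add: "vle v (val v x) (val v (x + y)) \<or> vle v (val v y) (val v (x + y))"

definition val_equiv :: "('a, 'g) valuation \<Rightarrow> ('a, 'h) valuation \<Rightarrow> bool" where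
  "val_equiv v w \<longleftrightarrow> (\<exists>\<phi> \<in> iso (value_group v) (value_group w).
     (\<forall>\<alpha> \<in> carrier (value_group v). \<forall>\<beta> \<in> carrier (value_group v).
        (\<alpha>, \<beta>) \<in> value_le v \<longleftrightarrow> (\<phi> \<alpha>, \<phi> \<beta>) \<in> value_le w) \<and>
     (\<forall>x. val w x = map_option \<phi> (val v x)))"

definition val_equiv_rel :: "('a::field, 'g) valuation rel" where
  "val_equiv_rel = {(v, w). krull_valuation v \<and> krull_valuation w \<and> val_equiv v w}"

text \<open>
  It is enough to let the elements of the value groups be of type \<^typ>\<open>'a set\<close>: by
  \<open>S_val_complete\<close> below, this misses no equivalence class.
\<close>

definition S_val :: "('a::field, 'a set) valuation set set" where
  "S_val = {v. krull_valuation v} // val_equiv_rel"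

section \<open>Valuation ring and residue field\<close>

definition valuation_ring :: "('a::field, 'g) valuation \<Rightarrow> 'a ring" where
  "valuation_ring v =
     \<lparr>carrier = {x. vle v (vzero v) (val v x)}, mult = (*), one = 1, zero = 0, add = (+)\<rparr>"

definition valuation_ideal :: "('a::field, 'g) valuation \<Rightarrow> 'a set" where
  "valuation_ideal v = {x. vless v (vzero v) (val v x)}"

definition residue_field :: "('a::field, 'g) valuation \<Rightarrow> 'a set ring" where
  "residue_field v = valuation_ring v Quot valuation_ideal v"

text \<open>
  The polynomials of HOL-Algebra are coefficient lists starting with the leading
  coefficient, whereas \<^const>\<open>coeffs\<close> starts with the constant one.
\<close>

definition reduction :: "('a::field, 'g) valuation \<Rightarrow> 'a poly \<Rightarrow> 'a set list" where
  "reduction v f = map (\<lambda>c. valuation_ideal v +>\<^bsub>valuation_ring v\<^esub> c) (rev (coeffs f))"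

section \<open>Topologies\<close>

definition zariski :: "('a::field, 'a set) valuation set topology" where
  "zariski = topology_generated_by
     (range (\<lambda>x. {V \<in> S_val. \<forall>v\<in>V. vle v (vzero v) (val v x)}))"

text \<open>
  The complements of the quasi-compact open sets generate the open sets, that is, the
  quasi-compact open sets themselves form a basis of closed sets; finite unions of
  quasi-compact open sets are again such sets.
\<close>

definition hochster_dual :: "'b topology \<Rightarrow> 'b topology" where
  "hochster_dual T = topology_generated_by
     {topspace T - U | U. openin T U \<and> compactin T U}"

section \<open>Adequacy of the encoding\<close>

lemma val_in_carrier:
  assumes "krull_valuation v" "val v x = Some \<alpha>"
  shows "\<alpha> \<in> carrier (value_group v)"
proof -
  have "Some \<alpha> \<in> range (val v)" using assms(2) by (metis rangeI)
  then show ?thesis using krull_valuation.val_range[OF assms(1)] by auto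
qed

lemma val_equiv_refl: "val_equiv v v"
  unfolding val_equiv_def
  by (rule bexI[where x = "\<lambda>x. x"]) (auto simp: iso_def hom_def bij_betw_def option.map_ident)

lemma val_equiv_sym:
  assumes "krull_valuation v" "krull_valuation w" "val_equiv v w"
  shows "val_equiv w v"
proof -
  interpret v: krull_valuation v by fact
  obtain \<phi> where \<phi>: "\<phi> \<in> iso (value_group v) (value_group w)"
    and le: "\<And>\<alpha> \<beta>. \<lbrakk>\<alpha> \<in> carrier (value_group v); \<beta> \<in> carrier (value_group v)\<rbrakk>
        \<Longrightarrow> (\<alpha>, \<beta>) \<in> value_le v \<longleftrightarrow> (\<phi> \<alpha>, \<phi> \<beta>) \<in> value_le w"
    and val: "\<And>x. val w x = map_option \<phi> (val v x)"
    using assms(3) unfolding val_equiv_def by blast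
  let ?\<psi> = "inv_into (carrier (value_group v)) \<phi>"
  have bij: "bij_betw \<phi> (carrier (value_group v)) (carrier (value_group w))"
    using \<phi> by (simp add: iso_def)
  have "?\<psi> \<in> iso (value_group w) (value_group v)"
    by (rule v.iso_set_sym[OF \<phi>])
  moreover have "(\<alpha>, \<beta>) \<in> value_le w \<longleftrightarrow> (?\<psi> \<alpha>, ?\<psi> \<beta>) \<in> value_le v"
    if "\<alpha> \<in> carrier (value_group w)" "\<beta> \<in> carrier (value_group w)" for \<alpha> \<beta>
  proof -
    have "?\<psi> \<alpha> \<in> carrier (value_group v)" "?\<psi> \<beta> \<in> carrier (value_group v)"
      using that bij by (simp_all add: bij_betw_def inv_into_into)
    from le[OF this] show ?thesis
      using that by (simp add: bij_betw_inv_into_right[OF bij])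
  qed
  moreover have "val v x = map_option ?\<psi> (val w x)" for x
    using val_in_carrier[OF assms(1), of x]
    by (cases "val v x") (simp_all add: val bij_betw_inv_into_left[OF bij])
  ultimately show ?thesis unfolding val_equiv_def by blast
qed

lemma val_equiv_trans:
  assumes "krull_valuation u" "val_equiv u v" "val_equiv v w"
  shows "val_equiv u w"
proof -
  obtain \<phi> where \<phi>: "\<phi> \<in> iso (value_group u) (value_group v)"
    "\<And>\<alpha> \<beta>. \<lbrakk>\<alpha> \<in> carrier (value_group u); \<beta> \<in> carrier (value_group u)\<rbrakk>
        \<Longrightarrow> (\<alpha>, \<beta>) \<in> value_le u \<longleftrightarrow> (\<phi> \<alpha>, \<phi> \<beta>) \<in> value_le v"
    "\<And>x. val v x = map_option \<phi> (val u x)"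
    using assms(2) unfolding val_equiv_def by blast
  obtain \<psi> where \<psi>: "\<psi> \<in> iso (value_group v) (value_group w)"
    "\<And>\<alpha> \<beta>. \<lbrakk>\<alpha> \<in> carrier (value_group v); \<beta> \<in> carrier (value_group v)\<rbrakk>
        \<Longrightarrow> (\<alpha>, \<beta>) \<in> value_le v \<longleftrightarrow> (\<psi> \<alpha>, \<psi> \<beta>) \<in> value_le w"
    "\<And>x. val w x = map_option \<psi> (val v x)"
    using assms(3) unfolding val_equiv_def by blast
  interpret u: krull_valuation u by fact
  have mem: "\<phi> \<alpha> \<in> carrier (value_group v)" if "\<alpha> \<in> carrier (value_group u)" for \<alpha>
    using \<phi>(1) that by (auto simp: iso_def hom_def)
  have "\<psi> \<circ> \<phi> \<in> iso (value_group u) (value_group w)"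
    using \<phi>(1) \<psi>(1) by (rule iso_set_trans)
  then show ?thesis
    unfolding val_equiv_def
    by (rule rev_bexI) (auto simp: \<phi>(2,3) \<psi>(2,3) mem option.map_comp)
qed

lemma equiv_val_equiv_rel: "equiv {v. krull_valuation v} val_equiv_rel"
proof (rule equivI)
  show "refl_on {v. krull_valuation v} val_equiv_rel"
    by (auto simp: refl_on_def val_equiv_rel_def val_equiv_refl)
  show "sym val_equiv_rel"
    by (rule symI) (auto simp: val_equiv_rel_def intro: val_equiv_sym)
  show "trans val_equiv_rel"
    by (rule transI) (auto simp: val_equiv_rel_def intro: val_equiv_trans)
qed (auto simp: val_equiv_rel_def)

lemma val_equiv_vle_iff:
  assumes "krull_valuation v" "val_equiv v w"
  shows "vle w (val w x) (val w y) \<longleftrightarrow> vle v (val v x) (val v y)"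
proof -
  obtain \<phi> where "\<And>\<alpha> \<beta>. \<lbrakk>\<alpha> \<in> carrier (value_group v); \<beta> \<in> carrier (value_group v)\<rbrakk>
        \<Longrightarrow> (\<alpha>, \<beta>) \<in> value_le v \<longleftrightarrow> (\<phi> \<alpha>, \<phi> \<beta>) \<in> value_le w"
    "\<And>x. val w x = map_option \<phi> (val v x)"
    using assms(2) unfolding val_equiv_def by blast
  then show ?thesis
    using val_in_carrier[OF assms(1)]
    by (auto simp: vle_def split: option.splits)
qed

text \<open>A valuation can be transported along any injection of its value group.\<close>

lemma transport_valuation:
  fixes w :: "('a::field, 'g) valuation" and c :: "'g \<Rightarrow> 'h"
  assumes "krull_valuation w" and inj: "inj_on c (carrier (value_group w))"
  shows "\<exists>v :: ('a, 'h) valuation. krull_valuation v \<and> val_equiv w v"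
proof -
  interpret w: krull_valuation w by fact
  let ?G = "value_group w"
  define d where "d = inv_into (carrier ?G) c"
  have dc: "d (c \<alpha>) = \<alpha>" if "\<alpha> \<in> carrier ?G" for \<alpha>
    unfolding d_def using inj that by simp
  define H :: "'h monoid" where
    "H = \<lparr>carrier = c ` carrier ?G, mult = (\<lambda>\<alpha> \<beta>. c (d \<alpha> \<otimes>\<^bsub>?G\<^esub> d \<beta>)), one = c \<one>\<^bsub>?G\<^esub>\<rparr>"
  define v :: "('a, 'h) valuation" where
    "v = \<lparr>value_group = H, value_le = map_prod c c ` (value_le w \<inter> carrier ?G \<times> carrier ?G),
          val = (\<lambda>x. map_option c (val w x))\<rparr>"
  have H: "carrier H = c ` carrier ?G" "\<one>\<^bsub>H\<^esub> = c \<one>\<^bsub>?G\<^esub>"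
    "\<And>\<alpha> \<beta>. \<alpha> \<otimes>\<^bsub>H\<^esub> \<beta> = c (d \<alpha> \<otimes>\<^bsub>?G\<^esub> d \<beta>)" by (auto simp: H_def)
  have v: "value_group v = H" "val v = (\<lambda>x. map_option c (val w x))" by (auto simp: v_def)
  have iso: "c \<in> iso ?G H"
    using inj by (auto simp: iso_def hom_def bij_betw_def H dc)
  have le: "(c \<alpha>, c \<beta>) \<in> value_le v \<longleftrightarrow> (\<alpha>, \<beta>) \<in> value_le w"
    if "\<alpha> \<in> carrier ?G" "\<beta> \<in> carrier ?G" for \<alpha> \<beta>
  proof
    assume "(c \<alpha>, c \<beta>) \<in> value_le v"
    then obtain \<alpha>' \<beta>' where "(\<alpha>', \<beta>') \<in> value_le w" "\<alpha>' \<in> carrier ?G" "\<beta>' \<in> carrier ?G"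
      "c \<alpha> = c \<alpha>'" "c \<beta> = c \<beta>'" by (auto simp: v_def)
    then show "(\<alpha>, \<beta>) \<in> value_le w" using that inj_onD[OF inj] by metis
  next
    assume "(\<alpha>, \<beta>) \<in> value_le w"
    then have "(\<alpha>, \<beta>) \<in> value_le w \<inter> carrier ?G \<times> carrier ?G" using that by simp
    then have "map_prod c c (\<alpha>, \<beta>) \<in> map_prod c c ` (value_le w \<inter> carrier ?G \<times> carrier ?G)"
      by (rule imageI)
    then show "(c \<alpha>, c \<beta>) \<in> value_le v" by (simp add: v_def)
  qed
  have lev: "value_le v \<subseteq> c ` carrier ?G \<times> c ` carrier ?G" by (auto simp: v_def)
  have lo: "linear_order_on (carrier ?G) (value_le w)" by (rule w.linear_order)
  have tr: "trans (value_le w)" and an: "antisym (value_le w)"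
    using lo by (simp_all add: order_on_defs)
  have comm: "comm_group H"
  proof -
    have "comm_group (H\<lparr>one := c \<one>\<^bsub>?G\<^esub>\<rparr>)"
      by (rule w.iso_imp_img_comm_group[OF iso])
    then show ?thesis by (simp add: H_def)
  qed
  have vle_iff: "vle v (val v x) (val v y) \<longleftrightarrow> vle w (val w x) (val w y)" for x y
    using val_in_carrier[OF assms(1), of x] val_in_carrier[OF assms(1), of y]
    by (cases "val w x"; cases "val w y") (simp_all add: vle_def v(2) le)
  have "krull_valuation v"
  proof (intro krull_valuation.intro ordered_comm_group.intro
      ordered_comm_group_axioms.intro krull_valuation_axioms.intro)
    show "comm_group (value_group v)" using comm by (simp add: v)
    show "linear_order_on (carrier (value_group v)) (value_le v)"
      unfolding order_on_defs v H
    proof (intro conjI)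
      show "value_le v \<subseteq> c ` carrier ?G \<times> c ` carrier ?G" by (rule lev)
      show "refl_on (c ` carrier ?G) (value_le v)"
        using lo by (auto simp: order_on_defs refl_on_def le)
      show "trans (value_le v)"
      proof (rule transI)
        fix a b e assume ab: "(a, b) \<in> value_le v" and be: "(b, e) \<in> value_le v"
        obtain \<alpha> \<beta> \<gamma> where abe: "a = c \<alpha>" "b = c \<beta>" "e = c \<gamma>"
          "\<alpha> \<in> carrier ?G" "\<beta> \<in> carrier ?G" "\<gamma> \<in> carrier ?G"
          using subsetD[OF lev ab] subsetD[OF lev be] by blast
        from abe ab be have "(\<alpha>, \<beta>) \<in> value_le w" "(\<beta>, \<gamma>) \<in> value_le w"
          by (simp_all add: le)
        then have "(\<alpha>, \<gamma>) \<in> value_le w" by (rule transD[OF tr])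
        then show "(a, e) \<in> value_le v" using abe by (simp add: le)
      qed
      show "antisym (value_le v)"
      proof (rule antisymI)
        fix a b assume ab: "(a, b) \<in> value_le v" and ba: "(b, a) \<in> value_le v"
        obtain \<alpha> \<beta> where abe: "a = c \<alpha>" "b = c \<beta>" "\<alpha> \<in> carrier ?G" "\<beta> \<in> carrier ?G"
          using subsetD[OF lev ab] by blast
        from abe ab ba have "(\<alpha>, \<beta>) \<in> value_le w" "(\<beta>, \<alpha>) \<in> value_le w"
          by (simp_all add: le)
        then have "\<alpha> = \<beta>" by (rule antisymD[OF an])
        then show "a = b" using abe by simp
      qed
      show "total_on (c ` carrier ?G) (value_le v)"
        using lo unfolding order_on_defs total_on_def by (auto simp: le)
    qed
    show "(\<alpha> \<otimes>\<^bsub>value_group v\<^esub> \<gamma>, \<beta> \<otimes>\<^bsub>value_group v\<^esub> \<gamma>) \<in> value_le v"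
      if "\<alpha> \<in> carrier (value_group v)" "\<beta> \<in> carrier (value_group v)"
        "\<gamma> \<in> carrier (value_group v)" "(\<alpha>, \<beta>) \<in> value_le v" for \<alpha> \<beta> \<gamma>
      using that by (auto simp: v H dc le w.translation)
    show "range (val v) = insert None (Some ` carrier (value_group v))"
    proof -
      have "range (val v) = map_option c ` range (val w)" by (auto simp: v)
      also have "\<dots> = insert None (Some ` carrier (value_group v))"
        unfolding w.val_range by (auto simp: v H image_image)
      finally show ?thesis .
    qed
    show "val v x = None \<longleftrightarrow> x = 0" for x
      by (simp add: v w.val_eq_infinity)
    show "val v (x * y) = vplus v (val v x) (val v y)" for x y
      using val_in_carrier[OF assms(1), of x] val_in_carrier[OF assms(1), of y]
      by (cases "val w x"; cases "val w y") (simp_all add: v w.val_mult vplus_def H dc)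
    show "vle v (val v x) (val v (x + y)) \<or> vle v (val v y) (val v (x + y))" for x y
      unfolding vle_iff by (rule w.val_add)
  qed
  moreover have "val_equiv w v"
    unfolding val_equiv_def
    by (rule bexI[of _ c]) (use iso le in \<open>auto simp: v\<close>)
  ultimately show ?thesis by blast
qed

theorem S_val_complete:
  fixes w :: "('a::field, 'g) valuation"
  assumes "krull_valuation w"
  shows "\<exists>V \<in> S_val. \<forall>v\<in>V. krull_valuation v \<and> val_equiv w v"
proof -
  interpret w: krull_valuation w by fact
  have "inj_on (\<lambda>\<alpha>. {x. val w x = Some \<alpha>}) (carrier (value_group w))"
  proof (rule inj_onI)
    fix \<alpha> \<beta> assume \<alpha>: "\<alpha> \<in> carrier (value_group w)"
      and eq: "{x. val w x = Some \<alpha>} = {x. val w x = Some \<beta>}"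
    have "Some \<alpha> \<in> range (val w)" unfolding w.val_range using \<alpha> by blast
    then obtain x where "val w x = Some \<alpha>" by (metis rangeE)
    moreover from this have "val w x = Some \<beta>" using eq by blast
    ultimately show "\<alpha> = \<beta>" by simp
  qed
  then obtain v :: "('a, 'a set) valuation" where v: "krull_valuation v" "val_equiv w v"
    using transport_valuation[OF assms] by blast
  have "val_equiv_rel `` {v} \<in> S_val" unfolding S_val_def by (rule quotientI) (simp add: v)
  moreover have "krull_valuation u \<and> val_equiv w u" if "u \<in> val_equiv_rel `` {v}" for u
  proof -
    have "krull_valuation u" "val_equiv v u" using that by (simp_all add: val_equiv_rel_def)
    then show ?thesis using val_equiv_trans[OF assms v(2)] by simp
  qed
  ultimately show ?thesis by blast
qed

end

theory Submission
  imports Defs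
begin

text \<open>
  Let \<open>R\<^sub>i\<close> be the intersection of the valuation rings of \<open>S\<^sub>i\<close>, let \<open>R\<close> be the intersection of the
  \<open>R\<^sub>i\<close>, and let \<open>d\<close> be the degree of \<open>f\<close>. By (U), all \<open>y ^ k / f y\<close> with \<open>k \<le> d\<close> lie in \<open>R\<close>. As they
  generate the unit ideal, the localization of \<open>R\<close>, and of any ring between \<open>R\<close> and \<open>K\<close>, at a prime
  of \<open>R\<close> is a valuation ring.

  Every valuation ring \<open>B\<close> containing \<open>R\<^sub>i\<close> belongs to \<open>S\<^sub>i\<close>: otherwise (T) yields finitely many
  elements outside \<open>B\<close> such that each valuation ring of \<open>S\<^sub>i\<close> contains one of them, and \<open>f\<close> allows
  to combine these into a single element of \<open>R\<^sub>i\<close> outside \<open>B\<close>. Hence (I) applies to all valuation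
  rings containing \<open>R\<^sub>i\<close> and \<open>R\<^sub>j\<close>, and the approximation problem is solved locally at each prime of
  \<open>R\<close>, where the localizations of the \<open>R\<^sub>i\<close> form a chain.
\<close>

section \<open>Rings over which a polynomial has no zeros\<close>

locale field_subring =
  fixes A :: "'a::field set"
  assumes one_mem: "1 \<in> A"
    and diff_mem: "a \<in> A \<Longrightarrow> b \<in> A \<Longrightarrow> a - b \<in> A"
    and mult_mem: "a \<in> A \<Longrightarrow> b \<in> A \<Longrightarrow> a * b \<in> A"
begin

lemma zero_mem: "0 \<in> A"
  using diff_mem[OF one_mem one_mem] by simp

lemma minus_mem: "a \<in> A \<Longrightarrow> - a \<in> A"
  using diff_mem[OF zero_mem] by simp

lemma add_mem: "a \<in> A \<Longrightarrow> b \<in> A \<Longrightarrow> a + b \<in> A"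
  using diff_mem[OF _ minus_mem] by fastforce

lemma power_mem: "a \<in> A \<Longrightarrow> a ^ k \<in> A"
  by (induction k) (auto intro: one_mem mult_mem)

lemma sum_mem: "(\<And>i. i \<in> I \<Longrightarrow> g i \<in> A) \<Longrightarrow> sum g I \<in> A"
  by (induction I rule: infinite_finite_induct) (auto intro: zero_mem add_mem)

lemma prod_mem: "(\<And>i. i \<in> I \<Longrightarrow> g i \<in> A) \<Longrightarrow> prod g I \<in> A"
  by (induction I rule: infinite_finite_induct) (auto intro: one_mem mult_mem)

lemma poly_mem: "(\<And>k. coeff f k \<in> A) \<Longrightarrow> y \<in> A \<Longrightarrow> poly f y \<in> A"
  by (auto simp: poly_altdef intro!: sum_mem mult_mem power_mem)

end

lemma field_subring_INT:
  assumes "\<And>i. i \<in> I \<Longrightarrow> field_subring (A i)"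
  shows "field_subring (\<Inter>i\<in>I. A i)"
  using assms by (auto simp: field_subring_def)

locale valuation_subring = field_subring +
  assumes mem_or_inverse_mem: "a \<in> A \<or> inverse a \<in> A"
begin

text \<open>A case of integral closedness: if \<open>a\<close> is outside \<open>A\<close>, its
  inverse is inside, and \<open>k - 1\<close> factors of it turn \<open>a ^ k\<close> into
  \<open>a\<close>.\<close>

lemma power_mem_imp_mem:
  assumes "a ^ k \<in> A" "k > 0"
  shows "a \<in> A"
proof (rule ccontr)
  assume a: "a \<notin> A"
  then have "inverse a \<in> A" "a \<noteq> 0"
    using mem_or_inverse_mem zero_mem by auto
  then have "a ^ k * inverse a ^ (k - 1) \<in> A"
    by (intro mult_mem power_mem assms)
  moreover have "a ^ k * inverse a ^ (k - 1) = a"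
    using \<open>a \<noteq> 0\<close> \<open>k > 0\<close> by (cases k) (auto simp: field_simps)
  ultimately show False using a by simp
qed

end

text \<open>Let \<open>b\<close> lie in \<open>C\<close> but not in \<open>B\<close>, and let
  \<open>c \<noteq> 0\<close> lie in \<open>B\<close>. Then \<open>b / c\<close> is not in
  \<open>A\<close>, since otherwise \<open>b\<close> would be in \<open>B\<close>. Hence
  \<open>c / b\<close> is in \<open>A\<close>, and \<open>c = c / b * b\<close> is in
  \<open>C\<close>.\<close>

lemma overrings_comparable:
  assumes A: "valuation_subring A" "A \<subseteq> B" "A \<subseteq> C"
    and B: "field_subring B" and C: "field_subring C"
  shows "B \<subseteq> C \<or> C \<subseteq> B"
proof (rule disjCI, rule subsetI)
  fix c assume nle: "\<not> C \<subseteq> B" and c: "c \<in> B"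
  then obtain b where b: "b \<in> C" "b \<notin> B" by blast
  have "b \<noteq> 0" using b field_subring.zero_mem[OF B] by auto
  consider "c = 0" | "c / b \<in> A" | "b / c \<in> A" "c \<noteq> 0"
    using valuation_subring.mem_or_inverse_mem[OF A(1), of "c / b"]
    by (auto simp: inverse_eq_divide)
  then show "c \<in> C"
  proof cases
    case 1
    then show ?thesis using field_subring.zero_mem[OF C] by simp
  next
    case 2
    then have "c / b * b \<in> C" using A(3) b by (intro field_subring.mult_mem[OF C]) auto
    then show ?thesis using \<open>b \<noteq> 0\<close> by simp
  next
    case 3
    then have "b / c * c \<in> B" using A(2) c by (intro field_subring.mult_mem[OF B]) auto
    then show ?thesis using \<open>c \<noteq> 0\<close> b by simp
  qed
qed

text \<open>
  For a valuation ring \<open>A\<close>, this means that \<open>f\<close> has coefficients in \<open>A\<close> and no zero in the residue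
  field. Unlike that condition, it makes sense for, and passes to, intersections and overrings.
\<close>
definition rootless_over :: "'a::field poly \<Rightarrow> 'a set \<Rightarrow> bool" where
  "rootless_over f A \<longleftrightarrow> (\<forall>k. coeff f k \<in> A) \<and>
     (\<forall>y. poly f y \<noteq> 0 \<and> (\<forall>k\<le>degree f. y ^ k / poly f y \<in> A))"

lemma rootless_over_mono: "rootless_over f A \<Longrightarrow> A \<subseteq> B \<Longrightarrow> rootless_over f B"
  unfolding rootless_over_def by blast

text \<open>An empty intersection would be the whole field, where \<open>f\<close> may have a
  zero.\<close>

lemma rootless_over_INT:
  assumes "I \<noteq> {}" "\<And>i. i \<in> I \<Longrightarrow> rootless_over f (A i)"
  shows "rootless_over f (\<Inter>i\<in>I. A i)"
  using assms unfolding rootless_over_def by blast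

text \<open>
  In terms of the valuation \<open>w\<close> of \<open>W\<close>, the witness \<open>b ^ d / f (b / a)\<close>, where \<open>d\<close> is the degree
  of \<open>f\<close>, has the value \<open>d * max (w a) (w b)\<close>.
\<close>
lemma rootless_over_pair:
  fixes f :: "'a::field poly"
  assumes W: "valuation_subring W" and f: "rootless_over f W" "degree f > 0"
    and ab: "a \<notin> W" "b \<notin> W"
    and \<C>: "\<And>C. C \<in> \<C> \<Longrightarrow> field_subring C \<and> rootless_over f C"
  shows "\<exists>c. c \<notin> W \<and> (\<forall>C\<in>\<C>. a \<in> C \<or> b \<in> C \<longrightarrow> c \<in> C)"
proof -
  interpret W: valuation_subring W by fact
  define d where "d = degree f"
  define t where "t = b / a"
  define c where "c = b ^ d / poly f t"
  have nz: "a \<noteq> 0" "b \<noteq> 0" "t \<noteq> 0" using ab W.zero_mem by (auto simp: t_def)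
  have ft: "poly f t \<noteq> 0" using f by (auto simp: rootless_over_def)
  have b: "b = a * t" using nz by (simp add: t_def)
  \<comment> \<open>If \<open>t\<close> is in \<open>W\<close>, so is \<open>poly f t\<close>, and
    \<open>c\<close> times it is \<open>b ^ d\<close>. Otherwise \<open>poly f t / t ^ d\<close> is
    in \<open>W\<close>, as a polynomial in \<open>inverse t\<close>, and \<open>c\<close> times it
    is \<open>a ^ d\<close>.\<close>
  have "c \<notin> W"
  proof
    assume c: "c \<in> W"
    show False
    proof (cases "t \<in> W")
      case True
      then have "c * poly f t \<in> W"
        using c f by (intro W.mult_mem W.poly_mem) (auto simp: rootless_over_def)
      then have "b ^ d \<in> W" using ft by (simp add: c_def)
      then show False using W.power_mem_imp_mem ab f by (auto simp: d_def)
    next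
      case False
      then have t: "inverse t \<in> W" using W.mem_or_inverse_mem by blast
      have "poly f t / t ^ d = (\<Sum>k\<le>d. coeff f k * inverse t ^ (d - k))"
        using nz by (auto simp: poly_altdef d_def sum_divide_distrib power_diff field_simps
            intro!: sum.cong)
      also have "\<dots> \<in> W"
        using f t by (intro W.sum_mem W.mult_mem W.power_mem) (auto simp: rootless_over_def)
      finally have "c * (poly f t / t ^ d) \<in> W" by (intro W.mult_mem c)
      moreover have "c * (poly f t / t ^ d) = a ^ d"
        using ft nz by (simp add: c_def b power_mult_distrib)
      ultimately show False using W.power_mem_imp_mem ab f by (auto simp: d_def)
    qed
  qed
  moreover have "c \<in> C" if C: "C \<in> \<C>" "a \<in> C \<or> b \<in> C" for C
  proof -
    interpret C: field_subring C using \<C> C by blast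
    have f': "rootless_over f C" using \<C> C by blast
    \<comment> \<open>The two extreme fractions suffice: \<open>c\<close> is both
      \<open>b ^ d * (1 / poly f t)\<close> and \<open>a ^ d * (t ^ d / poly f t)\<close>.\<close>
    have "t ^ 0 / poly f t \<in> C" "t ^ d / poly f t \<in> C"
      using f' unfolding rootless_over_def d_def by blast+
    then have "b \<in> C \<Longrightarrow> b ^ d * (t ^ 0 / poly f t) \<in> C" "a \<in> C \<Longrightarrow> a ^ d * (t ^ d / poly f t) \<in> C"
      by (intro C.mult_mem C.power_mem; simp)+
    then show ?thesis using C by (auto simp: c_def b power_mult_distrib)
  qed
  ultimately show ?thesis by blast
qed

text \<open>Repeated merging of pairs: \<open>b\<close> already serves for all of \<open>E\<close>
  and is merged with the new element \<open>a\<close>.\<close>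

lemma rootless_over_finite:
  fixes f :: "'a::field poly"
  assumes W: "valuation_subring W" and f: "rootless_over f W" "degree f > 0"
    and E: "finite E" "E \<noteq> {}" "E \<inter> W = {}"
    and \<C>: "\<And>C. C \<in> \<C> \<Longrightarrow> field_subring C \<and> rootless_over f C"
  shows "\<exists>c. c \<notin> W \<and> (\<forall>C\<in>\<C>. E \<inter> C \<noteq> {} \<longrightarrow> c \<in> C)"
  using E
proof (induction E rule: finite_ne_induct)
  case (singleton a)
  then show ?case by auto
next
  case (insert a E)
  then obtain b where b: "b \<notin> W" "\<forall>C\<in>\<C>. E \<inter> C \<noteq> {} \<longrightarrow> b \<in> C" by auto
  obtain c where c: "c \<notin> W" "\<forall>C\<in>\<C>. a \<in> C \<or> b \<in> C \<longrightarrow> c \<in> C"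
    using rootless_over_pair[OF W f _ b(1), of a \<C>] \<C> insert.prems by auto
  from b(2) c(2) have "\<forall>C\<in>\<C>. insert a E \<inter> C \<noteq> {} \<longrightarrow> c \<in> C" by blast
  then show ?case using c(1) by blast
qed

section \<open>The maximal ideal of a valuation ring\<close>

context valuation_subring
begin

text \<open>Zero is listed separately because \<open>inverse 0 = 0\<close> lies in \<open>A\<close>.
  The other elements belong to \<open>A\<close> since their inverses do not.\<close>

definition nonunits :: "'a set" where
  "nonunits = {a. a = 0 \<or> inverse a \<notin> A}"

lemma nonunits_subset: "nonunits \<subseteq> A"
  using mem_or_inverse_mem zero_mem by (auto simp: nonunits_def)

lemma zero_nonunits: "0 \<in> nonunits"
  by (simp add: nonunits_def)

lemma mult_nonunits:
  assumes "r \<in> A" "a \<in> nonunits"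
  shows "r * a \<in> nonunits"
proof (rule ccontr)
  assume "r * a \<notin> nonunits"
  then have ra: "r * a \<noteq> 0" "r * inverse (r * a) \<in> A"
    using assms(1) mult_mem[of r "inverse (r * a)"] by (simp_all only: nonunits_def) auto
  moreover have "r * inverse (r * a) = inverse a" using ra(1) by (simp add: field_simps)
  ultimately show False using assms(2) by (simp only: nonunits_def) auto
qed

text \<open>For nonzero summands, one of their two quotients lies in \<open>A\<close>, so the sum is
  a multiple \<open>(c / d + 1) * d\<close> of a nonunit.\<close>

lemma add_nonunits:
  assumes "a \<in> nonunits" "b \<in> nonunits"
  shows "a + b \<in> nonunits"
proof -
  have *: "c + d \<in> nonunits" if "c / d \<in> A" "d \<in> nonunits" "d \<noteq> 0" for c d
  proof -
    have "(c / d + 1) * d \<in> nonunits" using that by (intro mult_nonunits add_mem one_mem)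
    then show ?thesis using that by (simp add: algebra_simps)
  qed
  consider "a = 0" | "b = 0" | "a \<noteq> 0" "b \<noteq> 0" "a / b \<in> A" | "a \<noteq> 0" "b \<noteq> 0" "b / a \<in> A"
    using mem_or_inverse_mem[of "a / b"] by fastforce
  then show ?thesis
    using assms *[of a b] *[of b a] by cases (auto simp: add.commute)
qed

lemma minus_nonunits: "a \<in> nonunits \<Longrightarrow> - a \<in> nonunits"
  using mult_nonunits[OF minus_mem[OF one_mem]] by fastforce

text \<open>For \<open>y \<notin> A\<close>, the element \<open>f y / y ^ d\<close> is a unit, being congruent to the leading coefficient.\<close>
lemma rootless_overI:
  assumes f: "\<And>k. coeff f k \<in> A" "lead_coeff f = 1"
    and root: "\<And>y. y \<in> A \<Longrightarrow> poly f y \<notin> nonunits"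
  shows "rootless_over f A"
  unfolding rootless_over_def
proof (rule conjI; rule allI)
  fix y
  define d where "d = degree f"
  show "poly f y \<noteq> 0 \<and> (\<forall>k\<le>degree f. y ^ k / poly f y \<in> A)"
  proof (cases "y \<in> A")
    case True
    then have "poly f y \<noteq> 0" "inverse (poly f y) \<in> A"
      using root by (auto simp: nonunits_def)
    then show ?thesis using True by (auto simp: divide_inverse intro!: mult_mem power_mem)
  next
    case False
    define t where "t = inverse y"
    have y: "y \<noteq> 0" using False zero_mem by auto
    have t: "t \<in> nonunits" using False by (simp add: t_def nonunits_def)
    then have tA: "t \<in> A" using nonunits_subset by blast
    have tk: "t ^ k \<in> nonunits" if "k > 0" for k
      using that mult_nonunits[OF power_mem[OF tA] t, of "k - 1"] by (cases k) (auto simp: mult.commute)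
    define u where "u = poly f y / y ^ d"
    have "u = (\<Sum>k\<le>d. coeff f k * t ^ (d - k))"
      using y by (auto simp: u_def t_def poly_altdef d_def sum_divide_distrib power_diff field_simps
          intro!: sum.cong)
    also have "\<dots> = 1 + (\<Sum>k<d. coeff f k * t ^ (d - k))"
      using f by (simp add: lessThan_Suc_atMost[symmetric] d_def)
    finally have u: "u = 1 + (\<Sum>k<d. coeff f k * t ^ (d - k))" .
    \<comment> \<open>Each term has \<open>k < d\<close> and so contains a positive power of
      \<open>t\<close>; the premise \<open>j \<le> d\<close> preserves this along the
      induction.\<close>
    have "j \<le> d \<Longrightarrow> (\<Sum>k<j. coeff f k * t ^ (d - k)) \<in> nonunits" for j
    proof (induction j)
      case (Suc j)
      then have "coeff f j * t ^ (d - j) \<in> nonunits" by (intro mult_nonunits f tk) simp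
      then show ?case using Suc by (simp add: add_nonunits)
    qed (simp add: nonunits_def)
    then have "u - 1 \<in> nonunits" by (simp add: u)
    have unit: "u \<notin> nonunits"
    proof
      assume "u \<in> nonunits"
      from add_nonunits[OF this minus_nonunits[OF \<open>u - 1 \<in> nonunits\<close>]]
      show False using one_mem by (simp add: nonunits_def)
    qed
    have "y ^ k / poly f y \<in> A" if "k \<le> d" for k
    proof -
      have "inverse u * t ^ (d - k) \<in> A"
        using unit tA by (intro mult_mem power_mem) (auto simp: nonunits_def)
      moreover have "inverse u * t ^ (d - k) = y ^ k / poly f y"
        using y that by (auto simp: u_def t_def power_diff field_simps)
      ultimately show ?thesis by simp
    qed
    moreover have "poly f y \<noteq> 0" using unit by (auto simp: u_def nonunits_def)
    ultimately show ?thesis by (simp add: d_def)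
  qed
qed (fact f)

end

section \<open>Localization at prime ideals\<close>

definition ideal_in :: "'a::field set \<Rightarrow> 'a set \<Rightarrow> bool" where
  "ideal_in R J \<longleftrightarrow> J \<subseteq> R \<and> 0 \<in> J \<and> (\<forall>a\<in>J. \<forall>b\<in>J. a + b \<in> J) \<and> (\<forall>r\<in>R. \<forall>a\<in>J. r * a \<in> J)"

definition prime_ideal_in :: "'a::field set \<Rightarrow> 'a set \<Rightarrow> bool" where
  "prime_ideal_in R P \<longleftrightarrow> ideal_in R P \<and> 1 \<notin> P \<and> (\<forall>a\<in>R. \<forall>b\<in>R. a * b \<in> P \<longrightarrow> a \<in> P \<or> b \<in> P)"

text \<open>Zorn's lemma gives an ideal that is maximal among those containing \<open>J\<close> but
  not \<open>1\<close>, and such an ideal is prime.\<close>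

lemma prime_ideal_in_exists:
  assumes R: "field_subring R" and J: "ideal_in R J" "1 \<notin> J"
  shows "\<exists>P. prime_ideal_in R P \<and> J \<subseteq> P"
proof -
  interpret R: field_subring R by fact
  define \<A> where "\<A> = {M. ideal_in R M \<and> J \<subseteq> M \<and> 1 \<notin> M}"
  have "\<exists>M\<in>\<A>. \<forall>Q\<in>\<A>. M \<subseteq> Q \<longrightarrow> Q = M"
  proof (rule subset_Zorn_nonempty)
    show "\<A> \<noteq> {}" using J by (auto simp: \<A>_def)
    fix \<C> assume ne: "\<C> \<noteq> {}" and ch: "subset.chain \<A> \<C>"
    have id: "ideal_in R M" "J \<subseteq> M" "1 \<notin> M" if "M \<in> \<C>" for M
      using subsetD[of \<C> \<A> M] ch that by (simp_all add: subset_chain_def \<A>_def)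
    have total: "M \<subseteq> N \<or> N \<subseteq> M" if "M \<in> \<C>" "N \<in> \<C>" for M N
      using bspec[OF bspec[OF conjunct2[OF ch[unfolded subset_chain_def]] that(1)] that(2)] .
    have "a + b \<in> \<Union>\<C>" if "a \<in> \<Union>\<C>" "b \<in> \<Union>\<C>" for a b
    proof -
      from that obtain M N where MN: "a \<in> M" "M \<in> \<C>" "b \<in> N" "N \<in> \<C>"
        by (elim UnionE)
      have "M \<subseteq> N \<or> N \<subseteq> M" by (rule total[OF MN(2,4)])
      then obtain L where "L \<in> \<C>" "a \<in> L" "b \<in> L" using MN by (elim disjE) auto
      then show ?thesis using id(1)[of L] by (auto simp: ideal_in_def)
    qed
    moreover have "\<Union>\<C> \<subseteq> R" "0 \<in> \<Union>\<C>" "r \<in> R \<Longrightarrow> a \<in> \<Union>\<C> \<Longrightarrow> r * a \<in> \<Union>\<C>" for r a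
      using id ne unfolding ideal_in_def by blast+
    ultimately have "ideal_in R (\<Union>\<C>)" unfolding ideal_in_def by blast
    moreover have "J \<subseteq> \<Union>\<C>" "1 \<notin> \<Union>\<C>" using id ne by blast+
    ultimately show "\<Union>\<C> \<in> \<A>" by (simp add: \<A>_def)
  qed
  then obtain P where P: "ideal_in R P" "J \<subseteq> P" "1 \<notin> P"
    and max: "\<And>Q. ideal_in R Q \<Longrightarrow> P \<subseteq> Q \<Longrightarrow> 1 \<notin> Q \<Longrightarrow> Q = P"
    unfolding \<A>_def by auto
  have "b \<in> P" if ab: "a \<in> R" "b \<in> R" "a * b \<in> P" "a \<notin> P" for a b
  proof -
    \<comment> \<open>The ideal generated by \<open>P\<close> and \<open>a\<close>. By maximality it
      contains \<open>1 = p + r * a\<close>, and multiplication by \<open>b\<close> puts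
      \<open>b\<close> into \<open>P\<close>.\<close>
    define Q where "Q = {p + r * a | p r. p \<in> P \<and> r \<in> R}"
    have P0: "0 \<in> P" using P by (simp add: ideal_in_def)
    have QI: "p + r * a \<in> Q" if "p \<in> P" "r \<in> R" for p r using that Q_def by blast
    have "ideal_in R Q"
      unfolding ideal_in_def
    proof (intro conjI ballI)
      show "Q \<subseteq> R" using P ab by (auto simp: Q_def ideal_in_def intro: R.add_mem R.mult_mem)
      show "0 \<in> Q" using QI[OF P0 R.zero_mem] by simp
      fix u v assume "u \<in> Q" "v \<in> Q"
      then obtain p r p' r' where "u = p + r * a" "v = p' + r' * a" "p \<in> P" "r \<in> R" "p' \<in> P" "r' \<in> R"
        by (auto simp: Q_def)
      then have "u + v = (p + p') + (r + r') * a" "p + p' \<in> P" "r + r' \<in> R"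
        using P by (auto simp: ideal_in_def algebra_simps intro: R.add_mem)
      then show "u + v \<in> Q" unfolding Q_def by blast
    next
      fix s u assume "s \<in> R" "u \<in> Q"
      then obtain p r where "u = p + r * a" "p \<in> P" "r \<in> R"
        by (auto simp: Q_def)
      then have "s * u = s * p + (s * r) * a" "s * p \<in> P" "s * r \<in> R"
        using P \<open>s \<in> R\<close> by (auto simp: ideal_in_def algebra_simps intro: R.mult_mem)
      then show "s * u \<in> Q" unfolding Q_def by blast
    qed
    moreover have "P \<subseteq> Q" using QI[OF _ R.zero_mem] by auto
    moreover have "a \<in> Q" using QI[OF P0 R.one_mem] by simp
    ultimately have "1 \<in> Q" using max \<open>a \<notin> P\<close> by blast
    then obtain p r where pr: "1 = p + r * a" "p \<in> P" "r \<in> R" by (auto simp: Q_def)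
    have "b * p + r * (a * b) \<in> P"
      using P pr ab by (simp add: ideal_in_def)
    moreover have "b * p + r * (a * b) = b * (p + r * a)" by (simp add: algebra_simps)
    ultimately show ?thesis using pr by simp
  qed
  then show ?thesis using P unfolding prime_ideal_in_def by blast
qed

text \<open>The elements \<open>y ^ k / poly f y\<close> of \<open>R\<close>, weighted by the
  coefficients of \<open>f\<close>, add up to \<open>1\<close>, so one of them is outside
  \<open>P\<close>. Dividing a neighbour by it gives \<open>y\<close> or \<open>inverse y\<close>.
  The denominators come from \<open>R - P\<close> for every \<open>B\<close>, so all these rings
  contain the localization of \<open>R\<close>.\<close>

lemma valuation_subring_localization:
  fixes f :: "'a::field poly"
  assumes R: "field_subring R" and P: "prime_ideal_in R P"
    and f: "rootless_over f R" "degree f > 0"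
    and B: "field_subring B" "R \<subseteq> B"
  shows "valuation_subring {b / s | b s. b \<in> B \<and> s \<in> R - P}" (is "valuation_subring ?L")
proof -
  interpret R: field_subring R by fact
  interpret B: field_subring B by fact
  have P0: "0 \<in> P" and P1: "1 \<notin> P" using P by (auto simp: prime_ideal_in_def ideal_in_def)
  have mult: "s * t \<in> R - P" if "s \<in> R - P" "t \<in> R - P" for s t
    using that P R.mult_mem by (auto simp: prime_ideal_in_def)
  have sub: "b \<in> ?L" if "b \<in> B" for b
    using that R.one_mem P1 by (intro CollectI exI[of _ b] exI[of _ 1]) auto
  show ?thesis
  proof
    show "1 \<in> ?L" by (intro sub B.one_mem)
    fix u v assume "u \<in> ?L" "v \<in> ?L"
    then obtain b s c t where u: "u = b / s" "b \<in> B" "s \<in> R - P"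
      and v: "v = c / t" "c \<in> B" "t \<in> R - P" by blast
    have nz: "s \<noteq> 0" "t \<noteq> 0" using u v P0 by auto
    have "u - v = (b * t - c * s) / (s * t)" "b * t - c * s \<in> B"
      using nz u v B by (auto simp: field_simps intro!: B.diff_mem B.mult_mem)
    then show "u - v \<in> ?L" using mult[OF u(3) v(3)] by blast
    have "u * v = (b * c) / (s * t)" "b * c \<in> B"
      using u v by (auto intro!: B.mult_mem)
    then show "u * v \<in> ?L" using mult[OF u(3) v(3)] by blast
  next
    fix y :: 'a
    define e where "e k = y ^ k / poly f y" for k
    have fy: "poly f y \<noteq> 0" and e: "k \<le> degree f \<Longrightarrow> e k \<in> R" for k
      using f by (auto simp: rootless_over_def e_def)
    have "\<exists>k\<le>degree f. e k \<notin> P"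
    proof (rule ccontr)
      assume "\<not> ?thesis"
      then have "coeff f k * e k \<in> P" if "k \<le> degree f" for k
        using P f that by (auto simp: prime_ideal_in_def ideal_in_def rootless_over_def)
      then have "k \<le> degree f \<Longrightarrow> (\<Sum>i\<le>k. coeff f i * e i) \<in> P" for k
        by (induction k) (use P in \<open>auto simp: prime_ideal_in_def ideal_in_def\<close>)
      moreover have "(\<Sum>i\<le>degree f. coeff f i * e i) = 1"
        using fy by (simp add: e_def sum_divide_distrib[symmetric] poly_altdef)
      ultimately show False using P1 by fastforce
    qed
    then obtain k where k: "k \<le> degree f" "e k \<notin> P" by blast
    then have ek: "e k \<in> R - P" using e by blast
    show "y \<in> ?L \<or> inverse y \<in> ?L"
    proof (cases "y = 0")
      case True
      then show ?thesis using sub[OF B.zero_mem] by simp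
    next
      case False
      \<comment> \<open>The successor of \<open>e k\<close> serves while
        \<open>k < degree f\<close>; at the last index the predecessor is used, which exists because
        \<open>f\<close> is nonconstant.\<close>
      show ?thesis
      proof (cases "k < degree f")
        case True
        then have "y = e (Suc k) / e k" "e (Suc k) \<in> B"
          using fy \<open>y \<noteq> 0\<close> e[of "Suc k"] B by (auto simp: e_def)
        then show ?thesis using ek by blast
      next
        case False
        then obtain l where l: "k = Suc l" using f by (cases k) auto
        then have "inverse y = e l / e k" "e l \<in> B"
          using fy \<open>y \<noteq> 0\<close> e[of l] k B by (auto simp: e_def field_simps)
        then show ?thesis using ek by blast
      qed
    qed
  qed
qed

text \<open>
  If the ideal of all denominators \<open>r\<close> for which \<open>r * x i\<close> can be approximated were proper, it
  would lie in a prime \<open>P\<close>. The localizations of the rings \<open>R i\<close> at \<open>P\<close> are linearly ordered by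
  inclusion, and \<open>x i\<close> for the smallest one is a local solution, hence a contradiction.
\<close>
lemma approximation_by_localization:
  fixes f :: "'a::field poly" and x z :: "'i \<Rightarrow> 'a" and R :: "'i \<Rightarrow> 'a set"
  assumes fin: "finite I" and f: "degree f > 0"
    and R: "\<And>i. i \<in> I \<Longrightarrow> field_subring (R i) \<and> rootless_over f (R i)"
    and z: "\<And>i. i \<in> I \<Longrightarrow> z i \<noteq> 0"
    and loc: "\<And>i j B. \<lbrakk>i \<in> I; j \<in> I; valuation_subring B; R i \<subseteq> B; R j \<subseteq> B\<rbrakk>
                \<Longrightarrow> (x j - x i) / z i \<in> B"
  shows "\<exists>y. \<forall>i\<in>I. (y - x i) / z i \<in> R i"
proof (cases "I = {}")
  case ne: False
  define R0 where "R0 = (\<Inter>i\<in>I. R i)"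
  have R0: "field_subring R0" "rootless_over f R0"
    unfolding R0_def using R ne by (auto intro: field_subring_INT rootless_over_INT)
  interpret R0: field_subring R0 by fact
  define J where "J = {r \<in> R0. \<exists>y. \<forall>i\<in>I. (y - r * x i) / z i \<in> R i}"
  have J: "ideal_in R0 J"
    unfolding ideal_in_def
  proof (intro conjI ballI)
    show "J \<subseteq> R0" by (auto simp: J_def)
    show "0 \<in> J"
      using R0.zero_mem R by (auto simp: J_def intro!: exI[of _ 0] field_subring.zero_mem)
    fix a b assume "a \<in> J" "b \<in> J"
    then obtain y y' where *: "a \<in> R0" "b \<in> R0" "\<forall>i\<in>I. (y - a * x i) / z i \<in> R i"
      "\<forall>i\<in>I. (y' - b * x i) / z i \<in> R i" by (auto simp: J_def)
    have "(y + y' - (a + b) * x i) / z i \<in> R i" if "i \<in> I" for i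
    proof -
      have "(y + y' - (a + b) * x i) / z i = (y - a * x i) / z i + (y' - b * x i) / z i"
        by (simp add: add_divide_distrib[symmetric] algebra_simps)
      then show ?thesis using * R that by (simp add: field_subring.add_mem)
    qed
    then show "a + b \<in> J" using * R0.add_mem by (auto simp: J_def)
  next
    fix r a assume r: "r \<in> R0" and "a \<in> J"
    then obtain y where *: "a \<in> R0" "\<forall>i\<in>I. (y - a * x i) / z i \<in> R i" by (auto simp: J_def)
    have "(r * y - (r * a) * x i) / z i \<in> R i" if "i \<in> I" for i
    proof -
      have "(r * y - (r * a) * x i) / z i = r * ((y - a * x i) / z i)"
        by (simp add: right_diff_distrib mult.assoc)
      moreover have "r \<in> R i" using r that by (auto simp: R0_def)
      ultimately show ?thesis using * R that by (simp only: field_subring.mult_mem)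
    qed
    then show "r * a \<in> J" using * r R0.mult_mem by (auto simp: J_def)
  qed
  have "1 \<in> J"
  proof (rule ccontr)
    assume "1 \<notin> J"
    then obtain P where P: "prime_ideal_in R0 P" "J \<subseteq> P"
      using prime_ideal_in_exists[OF R0(1) J] by blast
    have P1: "1 \<notin> P" using P by (auto simp: prime_ideal_in_def)
    define L where "L B = {b / s | b s. b \<in> B \<and> s \<in> R0 - P}" for B
    have L: "valuation_subring (L B)" if "field_subring B" "R0 \<subseteq> B" for B
      unfolding L_def by (rule valuation_subring_localization[OF R0(1) P(1) R0(2) f that])
    have sub: "B \<subseteq> L B" for B
    proof
      fix b assume "b \<in> B"
      then show "b \<in> L B"
        unfolding L_def using R0.one_mem P1 by (intro CollectI exI[of _ b] exI[of _ 1]) auto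
    qed
    have R0R: "R0 \<subseteq> R i" if "i \<in> I" for i using that by (auto simp: R0_def)
    have LR: "valuation_subring (L (R i))" if "i \<in> I" for i using L R R0R that by blast
    have mono: "L R0 \<subseteq> L (R i)" if "i \<in> I" for i using R0R[OF that] by (auto simp: L_def)
    have cmp: "L (R i) \<subseteq> L (R j) \<or> L (R j) \<subseteq> L (R i)" if "i \<in> I" "j \<in> I" for i j
      using that LR mono L[OF R0(1)] by (intro overrings_comparable[of "L R0"])
        (auto simp: valuation_subring_def)
    \<comment> \<open>Finiteness of \<open>I\<close> yields a minimal localization; by comparability
      it is the least one.\<close>
    obtain m where m: "m \<in> I" "\<And>i. i \<in> I \<Longrightarrow> L (R m) \<subseteq> L (R i)"
    proof -
      obtain M where M: "M \<in> (\<lambda>i. L (R i)) ` I"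
        "\<And>Q. Q \<in> (\<lambda>i. L (R i)) ` I \<Longrightarrow> Q \<subseteq> M \<Longrightarrow> M = Q"
        using finite_has_minimal[of "(\<lambda>i. L (R i)) ` I"] fin ne by auto
      then obtain m where m: "m \<in> I" "M = L (R m)" by blast
      then have "L (R m) \<subseteq> L (R i)" if "i \<in> I" for i
        using M(2)[of "L (R i)"] cmp[OF that m(1)] that by auto
      then show ?thesis using that m by blast
    qed
    have "\<exists>s\<in>R0 - P. s * ((x m - x i) / z i) \<in> R i" if i: "i \<in> I" for i
    proof -
      \<comment> \<open>\<open>L (R i)\<close> is a valuation ring containing both
        \<open>R i\<close> and \<open>R m\<close>, so \<open>loc\<close> applies to it.\<close>
      have "R m \<subseteq> L (R i)" using sub m i by blast
      then have "(x m - x i) / z i \<in> L (R i)" using loc i m LR sub by blast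
      then obtain b s where "(x m - x i) / z i = b / s" "b \<in> R i" "s \<in> R0 - P"
        by (auto simp: L_def)
      moreover from this have "s \<noteq> 0" using P by (auto simp: prime_ideal_in_def ideal_in_def)
      ultimately show ?thesis by (intro bexI[of _ s]) auto
    qed
    then obtain s where s: "\<And>i. i \<in> I \<Longrightarrow> s i \<in> R0 - P"
      "\<And>i. i \<in> I \<Longrightarrow> s i * ((x m - x i) / z i) \<in> R i" by metis
    \<comment> \<open>A common denominator: \<open>t\<close> is outside \<open>P\<close> by
      primality, yet \<open>t * x m\<close> as the approximating element shows that \<open>t\<close>
      is in \<open>J\<close>.\<close>
    define t where "t = prod s I"
    have "t \<in> R0" using s unfolding t_def by (intro R0.prod_mem) auto
    have "prod s I' \<notin> P" if "I' \<subseteq> I" for I'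
      using finite_subset[OF that fin] that
    proof (induction I' rule: finite_induct)
      case (insert i I')
      then have "prod s I' \<in> R0" "s i \<in> R0 - P" using s by (auto intro!: R0.prod_mem)
      then show ?case using insert P by (auto simp: prime_ideal_in_def)
    qed (use P1 in simp)
    then have "t \<notin> P" by (simp add: t_def)
    moreover have "t \<in> J"
    proof -
      have "(t * x m - t * x i) / z i \<in> R i" if i: "i \<in> I" for i
      proof -
        have "t = prod s (I - {i}) * s i"
          unfolding t_def using prod.remove[OF fin i, of s] by (simp add: mult.commute)
        then have "(t * x m - t * x i) / z i = prod s (I - {i}) * (s i * ((x m - x i) / z i))"
          by (simp add: right_diff_distrib mult.assoc)
        moreover have "prod s (I - {i}) \<in> R i"
          using s R0R[OF i] by (intro subsetD[OF R0R[OF i]] R0.prod_mem) auto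
        ultimately show ?thesis using s(2)[OF i] R[OF i] by (simp only: field_subring.mult_mem)
      qed
      then show ?thesis using \<open>t \<in> R0\<close> by (auto simp: J_def)
    qed
    ultimately show False using P by blast
  qed
  then show ?thesis by (auto simp: J_def)
qed auto

section \<open>Valuations and their valuation rings\<close>

definition ring_on :: "'a::field set \<Rightarrow> 'a ring" where
  "ring_on A = \<lparr>carrier = A, mult = (*), one = 1, zero = 0, add = (+)\<rparr>"

lemma ring_on_sel [simp]:
  "carrier (ring_on A) = A" "mult (ring_on A) = (*)" "one (ring_on A) = 1"
  "zero (ring_on A) = 0" "add (ring_on A) = (+)"
  by (simp_all add: ring_on_def)

lemma ring_on_nat_pow [simp]: "a [^]\<^bsub>ring_on A\<^esub> (k::nat) = a ^ k"
  by (induction k) (simp_all add: nat_pow_def mult.commute)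

context field_subring
begin

lemma cring_ring_on: "cring (ring_on A)"
proof (rule cringI)
  show "abelian_group (ring_on A)"
  proof (rule abelian_groupI)
    fix a assume "a \<in> carrier (ring_on A)"
    then show "\<exists>y\<in>carrier (ring_on A). y \<oplus>\<^bsub>ring_on A\<^esub> a = \<zero>\<^bsub>ring_on A\<^esub>"
      using minus_mem by (intro bexI[of _ "- a"]) auto
  qed (auto intro: add_mem zero_mem simp: algebra_simps)
  show "comm_monoid (ring_on A)"
    by (rule comm_monoidI) (auto intro: mult_mem one_mem simp: algebra_simps)
qed (simp add: algebra_simps)

lemma eval_ring_on:
  assumes "set p \<subseteq> A" "a \<in> A"
  shows "ring.eval (ring_on A) p a = poly (Poly (rev p)) a"
proof -
  interpret cring "ring_on A" by (rule cring_ring_on)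
  \<comment> \<open>The lists of \<open>ring.eval\<close> start with the leading coefficient, so
    induction on \<open>p\<close> appends to the reversed list.\<close>
  have snoc: "poly (Poly (q @ [c])) a = poly (Poly q) a + c * a ^ length q" for q c
    by (induction q) (simp_all add: algebra_simps)
  show ?thesis
    using assms(1) by (induction p) (simp_all add: snoc)
qed

end

lemma (in valuation_subring) ideal_nonunits: "ideal nonunits (ring_on A)"
proof -
  have mult_nonunits': "a * r \<in> nonunits" if "a \<in> nonunits" "r \<in> A" for a r
    using mult_nonunits[OF that(2,1)] by (simp add: mult.commute)
  interpret cring "ring_on A" by (rule cring_ring_on)
  show ?thesis
  proof (rule idealI)
    show "ring (ring_on A)" by (rule ring_axioms)
    show "subgroup nonunits (add_monoid (ring_on A))"
    proof (rule add.subgroupI)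
      fix a assume a: "a \<in> nonunits"
      then have "\<ominus>\<^bsub>ring_on A\<^esub> a = - a"
        using nonunits_subset by (intro minus_equality) (auto intro: minus_mem)
      then show "\<ominus>\<^bsub>ring_on A\<^esub> a \<in> nonunits" using minus_nonunits[OF a] by simp
    qed (use nonunits_subset zero_nonunits in \<open>auto simp: add_nonunits\<close>)
  qed (simp_all add: mult_nonunits mult_nonunits')
qed

section \<open>The ring and the maximal ideal of a Krull valuation\<close>

context krull_valuation
begin

lemma val_cases:
  obtains "x = 0" "val v x = None"
  | \<alpha> where "x \<noteq> 0" "val v x = Some \<alpha>" "\<alpha> \<in> carrier (value_group v)"
  using val_in_carrier[OF krull_valuation_axioms, of x] val_eq_infinity[of x]
  by (cases "val v x") auto

lemma val_one: "val v 1 = vzero v"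
proof (cases rule: val_cases[of 1])
  case (2 \<alpha>)
  then have "\<alpha> \<otimes>\<^bsub>value_group v\<^esub> \<alpha> = \<alpha>" using val_mult[of 1 1] by (simp add: vplus_def)
  then have "\<alpha> = \<one>\<^bsub>value_group v\<^esub>" using 2 by simp
  then show ?thesis using 2 by (simp add: vzero_def)
qed simp

lemma vle_None: "vle v a None"
  by (simp add: vle_def split: option.split)

lemma vle_trans: "vle v a b \<Longrightarrow> vle v b c \<Longrightarrow> vle v a c"
  using linear_order by (auto simp: vle_def order_on_defs split: option.splits dest: transD)

lemma vle_linear: "vle v (val v x) (val v y) \<or> vle v (val v y) (val v x)"
proof (cases rule: val_cases[of x])
  case x: (2 \<alpha>)
  show ?thesis
  proof (cases rule: val_cases[of y])
    case (2 \<beta>)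
    then show ?thesis
      using x linear_order
      by (cases "\<alpha> = \<beta>") (auto simp: vle_def order_on_defs total_on_def refl_on_def)
  qed (simp add: vle_None)
qed (simp add: vle_None)

lemma vle_antisym: "vle v a b \<Longrightarrow> vle v b a \<Longrightarrow> a = b"
  using linear_order by (auto simp: vle_def order_on_defs split: option.splits dest: antisymD)

text \<open>Translation by the value of \<open>z\<close> and by its inverse. Comparisons of values
  thereby become memberships in the valuation ring.\<close>

lemma vle_iff_divide:
  assumes "z \<noteq> 0"
  shows "vle v (val v z) (val v a) \<longleftrightarrow> vle v (vzero v) (val v (a / z))"
proof (cases rule: val_cases[of "a / z"])
  case 1
  then show ?thesis using assms by (simp add: vle_None)
next
  case (2 \<gamma>)
  obtain \<zeta> where \<zeta>: "val v z = Some \<zeta>" "\<zeta> \<in> carrier (value_group v)"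
    using assms by (cases rule: val_cases[of z]) auto
  have a: "val v a = Some (\<gamma> \<otimes>\<^bsub>value_group v\<^esub> \<zeta>)"
    using val_mult[of "a / z" z] assms 2 \<zeta> by (simp add: vplus_def)
  have "(\<zeta>, \<gamma> \<otimes>\<^bsub>value_group v\<^esub> \<zeta>) \<in> value_le v \<longleftrightarrow> (\<one>\<^bsub>value_group v\<^esub>, \<gamma>) \<in> value_le v"
    using translation[of \<zeta> "\<gamma> \<otimes>\<^bsub>value_group v\<^esub> \<zeta>" "inv\<^bsub>value_group v\<^esub> \<zeta>"]
      translation[of "\<one>\<^bsub>value_group v\<^esub>" \<gamma> \<zeta>] 2 \<zeta>
    by (auto simp: m_assoc)
  then show ?thesis using a 2 \<zeta> by (simp add: vle_def vzero_def)
qed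

lemma valuation_subring: "valuation_subring (carrier (valuation_ring v))"
proof -
  let ?A = "{x. vle v (vzero v) (val v x)}"
  have tot: "a \<in> ?A \<or> inverse a \<in> ?A" for a
    using vle_linear[of 1 a] vle_iff_divide[of a 1]
    by (cases "a = 0") (auto simp: val_one vle_None val_eq_infinity[THEN iffD2] inverse_eq_divide)
  have one: "1 \<in> ?A" using tot[of 1] by simp
  have add: "a + b \<in> ?A" if "a \<in> ?A" "b \<in> ?A" for a b
    using that val_add[of a b] vle_trans by blast
  have mult: "a * b \<in> ?A" if "a \<in> ?A" "b \<in> ?A" for a b
  proof (cases "b = 0")
    case False
    then have "vle v (val v b) (val v (a * b))" using that by (simp add: vle_iff_divide)
    then show ?thesis using that vle_trans by blast
  qed (use that in simp)
  have "- 1 \<in> ?A" using tot[of "- 1"] by simp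
  then have "a - b \<in> ?A" if "a \<in> ?A" "b \<in> ?A" for a b
    using add[OF that(1) mult[OF _ that(2)], of "- 1"] by simp
  then have "valuation_subring ?A"
    using one mult tot by unfold_locales
  then show ?thesis by (simp add: valuation_ring_def)
qed

text \<open>For nonzero \<open>a\<close>, positivity of v(a) is the failure of v(a) \<le> v(1),
  which means the failure of v(1/a) \<ge> 0.\<close>

lemma valuation_ideal_eq:
  "valuation_ideal v = valuation_subring.nonunits (carrier (valuation_ring v))"
proof -
  have "vless v (vzero v) (val v a) \<longleftrightarrow> a = 0 \<or> \<not> vle v (vzero v) (val v (inverse a))" for a
  proof (cases "a = 0")
    case True
    then have "val v a = None" by (simp add: val_eq_infinity)
    then show ?thesis using True by (simp add: vless_def vle_def vzero_def)
  next
    case False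
    then have "vle v (vzero v) (val v (inverse a)) \<longleftrightarrow> vle v (val v a) (val v 1)"
      using vle_iff_divide[of a 1] by (simp add: inverse_eq_divide)
    then show ?thesis
      using False vle_linear[of 1 a] vle_linear[of 1 1] vle_antisym[of "val v a" "val v 1"]
      by (auto simp: vless_def val_one)
  qed
  then show ?thesis
    unfolding valuation_subring.nonunits_def[OF valuation_subring]
    by (simp add: valuation_ideal_def valuation_ring_def)
qed

text \<open>If \<open>poly f y\<close> were a nonunit, the residue class of \<open>y\<close> would
  be a zero of the reduction, because the quotient map is a ring homomorphism and commutes with
  evaluation.\<close>

lemma rootless_over_valuation_ring:
  assumes f: "\<And>k. coeff f k \<in> carrier (valuation_ring v)" "lead_coeff f = 1"
    and root: "\<not> (\<exists>a \<in> carrier (residue_field v).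
      ring.eval (residue_field v) (reduction v f) a = \<zero>\<^bsub>residue_field v\<^esub>)"
  shows "rootless_over f (carrier (valuation_ring v))"
proof -
  define A where "A = carrier (valuation_ring v)"
  interpret A: valuation_subring A unfolding A_def by (rule valuation_subring)
  have ring: "valuation_ring v = ring_on A" by (simp add: A_def valuation_ring_def ring_on_def)
  have M: "valuation_ideal v = A.nonunits" by (simp add: valuation_ideal_eq A_def)
  interpret Id: ideal A.nonunits "ring_on A" by (rule A.ideal_nonunits)
  have "poly f y \<notin> A.nonunits" if y: "y \<in> A" for y
  proof
    assume fy: "poly f y \<in> A.nonunits"
    define h where "h = (\<lambda>c. A.nonunits +>\<^bsub>ring_on A\<^esub> c)"
    interpret h: ring_hom_ring "ring_on A" "residue_field v" h
      unfolding residue_field_def ring M h_def by (rule Id.rcos_ring_hom_ring)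
    have set: "set (rev (coeffs f)) \<subseteq> A"
      using f(1) by (auto simp: A_def coeffs_def split: if_splits)
    have "ring.eval (residue_field v) (reduction v f) (h y) = h (ring.eval (ring_on A) (rev (coeffs f)) y)"
      unfolding reduction_def ring M h_def[symmetric]
      using h.eval_hom'[of y "rev (coeffs f)"] y set by simp
    also have "\<dots> = h (poly f y)" using A.eval_ring_on[OF set y] by simp
    also have "\<dots> = A.nonunits"
      unfolding h_def by (rule Id.a_rcos_const) (rule fy)
    also have "\<dots> = \<zero>\<^bsub>residue_field v\<^esub>"
      by (simp add: residue_field_def ring M FactRing_def)
    finally show False using root h.hom_closed[of y] y by auto
  qed
  then show ?thesis
    using A.rootless_overI[of f] f by (auto simp: A_def)
qed

end

section \<open>Correspondence between valuation rings and classes of valuations\<close>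

lemma krull_valuation_of_subring:
  fixes A :: "'a::field set"
  assumes "valuation_subring A"
  shows "\<exists>w :: ('a, 'a) valuation. krull_valuation w \<and> (\<forall>a. vle w (vzero w) (val w a) \<longleftrightarrow> a \<in> A)"
proof -
  interpret valuation_subring A by fact
  \<comment> \<open>The value group is the multiplicative group of the field modulo the units of
    \<open>A\<close>, ordered by divisibility. \<open>assoc\<close> is congruence modulo units;
    cosets are replaced by chosen representatives.\<close>
  define assoc where "assoc a b \<longleftrightarrow> a \<noteq> 0 \<and> b \<noteq> 0 \<and> a / b \<in> A \<and> b / a \<in> A" for a b
  have assoc_refl: "a \<noteq> 0 \<Longrightarrow> assoc a a" for a using one_mem by (simp add: assoc_def)
  have assoc_sym: "assoc a b \<Longrightarrow> assoc b a" for a b by (auto simp: assoc_def)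
  have div_trans: "c / a \<in> A" if "c / b \<in> A" "b / a \<in> A" "b \<noteq> 0" for a b c
    using mult_mem[OF that(1,2)] that(3) by simp
  have assoc_trans: "assoc a b \<Longrightarrow> assoc b c \<Longrightarrow> assoc a c" for a b c
    using div_trans[of a b c] div_trans[of c b a] by (auto simp: assoc_def)
  have assoc_mult: "assoc a b \<Longrightarrow> c \<noteq> 0 \<Longrightarrow> assoc (a * c) (b * c)" for a b c
    by (simp add: assoc_def)
  define rep where "rep a = (SOME b. assoc a b)" for a
  have rep: "assoc a (rep a)" if "a \<noteq> 0" for a
    unfolding rep_def using assoc_refl[OF that] by (rule someI)
  have rep_eq: "rep a = rep b" if "assoc a b" for a b
  proof -
    \<comment> \<open>Associated elements satisfy the same predicate, hence \<open>SOME\<close>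
      picks the same representative.\<close>
    have "assoc a = assoc b" using that assoc_sym assoc_trans by blast
    then show ?thesis by (simp add: rep_def)
  qed
  have rep_nz: "a \<noteq> 0 \<Longrightarrow> rep a \<noteq> 0" for a using rep by (auto simp: assoc_def)
  have rep_rep: "a \<noteq> 0 \<Longrightarrow> rep (rep a) = rep a" for a using rep rep_eq by metis
  have rep_mult: "rep (rep a * b) = rep (a * b)" if "a \<noteq> 0" "b \<noteq> 0" for a b
    using rep_eq[OF assoc_mult[OF rep[OF that(1)] that(2)]] by simp
  have rep_mult': "rep (b * rep a) = rep (b * a)" if "a \<noteq> 0" "b \<noteq> 0" for a b
    using rep_mult[OF that] by (simp add: mult.commute)
  have rep_div: "rep b / rep a \<in> A \<longleftrightarrow> b / a \<in> A" if "a \<noteq> 0" "b \<noteq> 0" for a b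
  proof
    assume "rep b / rep a \<in> A"
    then have "b / rep a \<in> A" using div_trans[of b "rep b" "rep a"] rep that rep_nz
      by (auto simp: assoc_def)
    then show "b / a \<in> A" using div_trans[of b "rep a" a] rep that rep_nz by (auto simp: assoc_def)
  next
    assume "b / a \<in> A"
    then have "rep b / a \<in> A" using div_trans[of "rep b" b a] rep that by (auto simp: assoc_def)
    then show "rep b / rep a \<in> A" using div_trans[of "rep b" a "rep a"] rep that
      by (auto simp: assoc_def)
  qed
  define C where "C = {r. r \<noteq> 0 \<and> rep r = r}"
  define G where "G = \<lparr>carrier = C, mult = (\<lambda>a b. rep (a * b)), one = rep 1\<rparr>"
  define le where "le = {(a, b). a \<in> C \<and> b \<in> C \<and> b / a \<in> A}"
  define w where "w = \<lparr>value_group = G, value_le = le,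
    val = (\<lambda>a. if a = 0 then None else Some (rep a))\<rparr>"
  have repC: "a \<noteq> 0 \<Longrightarrow> rep a \<in> C" for a using rep_nz rep_rep by (simp add: C_def)
  have Cnz: "a \<in> C \<Longrightarrow> a \<noteq> 0" and Crep: "a \<in> C \<Longrightarrow> rep a = a" for a by (auto simp: C_def)
  have G: "carrier G = C" "a \<otimes>\<^bsub>G\<^esub> b = rep (a * b)" "\<one>\<^bsub>G\<^esub> = rep 1" for a b
    by (simp_all add: G_def)
  have w: "value_group w = G" "value_le w = le"
    "val w a = (if a = 0 then None else Some (rep a))" for a by (simp_all add: w_def)
  have le_rep: "(rep a, rep b) \<in> le \<longleftrightarrow> b / a \<in> A" if "a \<noteq> 0" "b \<noteq> 0" for a b
    using that repC rep_div by (simp add: le_def)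
  have "krull_valuation w"
  proof (intro krull_valuation.intro ordered_comm_group.intro
      ordered_comm_group_axioms.intro krull_valuation_axioms.intro)
    show "comm_group (value_group w)"
      unfolding w
    proof (rule comm_groupI)
      fix a assume a: "a \<in> carrier G"
      then show "\<exists>b\<in>carrier G. b \<otimes>\<^bsub>G\<^esub> a = \<one>\<^bsub>G\<^esub>"
        using repC by (intro bexI[of _ "rep (inverse a)"]) (auto simp: G rep_mult Cnz)
    qed (auto simp: G repC Cnz Crep rep_mult rep_mult' ac_simps)
    show "linear_order_on (carrier (value_group w)) (value_le w)"
      unfolding w G order_on_defs
    proof (intro conjI)
      show "le \<subseteq> C \<times> C" by (auto simp: le_def)
      show "refl_on C le" using Cnz one_mem by (auto simp: refl_on_def le_def)
      show "trans le" by (rule transI) (use Cnz div_trans in \<open>auto simp: le_def\<close>)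
      show "antisym le"
      proof (rule antisymI)
        fix a b assume "(a, b) \<in> le" "(b, a) \<in> le"
        then have "assoc a b" "a \<in> C" "b \<in> C" using Cnz by (auto simp: le_def assoc_def)
        then show "a = b" using rep_eq Crep by metis
      qed
      show "total_on C le"
        unfolding total_on_def
      proof (intro ballI impI)
        fix a b assume "a \<in> C" "b \<in> C"
        then show "(a, b) \<in> le \<or> (b, a) \<in> le"
          using mem_or_inverse_mem[of "b / a"] by (auto simp: le_def)
      qed
    qed
    show "(a \<otimes>\<^bsub>value_group w\<^esub> c, b \<otimes>\<^bsub>value_group w\<^esub> c) \<in> value_le w"
      if "a \<in> carrier (value_group w)" "b \<in> carrier (value_group w)"
        "c \<in> carrier (value_group w)" "(a, b) \<in> value_le w" for a b c
      using that by (auto simp: w G Cnz le_rep) (simp add: le_def)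
    show "range (val w) = insert None (Some ` carrier (value_group w))"
    proof (intro equalityI subsetI)
      fix r assume "r \<in> insert None (Some ` carrier (value_group w))"
      then consider "r = None" | a where "r = Some a" "a \<in> C" by (auto simp: w G)
      then show "r \<in> range (val w)"
      proof cases
        case 1
        then have "r = val w 0" by (simp add: w)
        then show ?thesis by simp
      next
        case (2 a)
        then have "r = val w a" by (simp add: w Cnz Crep)
        then show ?thesis by simp
      qed
    qed (auto simp: w G repC)
    show "val w a = None \<longleftrightarrow> a = 0" for a by (simp add: w)
    show "val w (a * b) = vplus w (val w a) (val w b)" for a b
      by (simp add: w vplus_def G rep_mult rep_mult' rep_nz)
    show "vle w (val w a) (val w (a + b)) \<or> vle w (val w b) (val w (a + b))" for a b
    proof -
      consider "a = 0" | "b = 0" | "a + b = 0" | "a \<noteq> 0" "b \<noteq> 0" "a + b \<noteq> 0" by blast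
      then show ?thesis
      proof cases
        case 4
        have "b / a + 1 \<in> A \<or> a / b + 1 \<in> A"
          using mem_or_inverse_mem[of "b / a"] by (auto intro!: add_mem one_mem)
        then have "(a + b) / a \<in> A \<or> (a + b) / b \<in> A" using 4 by (simp add: field_simps)
        then show ?thesis using 4 le_rep by (simp add: vle_def w)
      qed (use le_rep one_mem in \<open>auto simp: vle_def w\<close>)
    qed
  qed
  moreover have "vle w (vzero w) (val w a) \<longleftrightarrow> a \<in> A" for a
    using le_rep[of 1 a] zero_mem by (simp add: vle_def vzero_def w G)
  ultimately show ?thesis by blast
qed

text \<open>On \<open>S_val\<close> this is the valuation ring of any representative
  (\<open>class_ring_eq\<close>). The quantifier avoids a choice and matches the subbasis of
  \<open>zariski\<close>.\<close>

definition class_ring :: "('a::field, 'a set) valuation set \<Rightarrow> 'a set" where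
  "class_ring V = {a. \<forall>v\<in>V. vle v (vzero v) (val v a)}"

lemma S_val_krull_valuation: "V \<in> S_val \<Longrightarrow> v \<in> V \<Longrightarrow> krull_valuation v"
  unfolding S_val_def val_equiv_rel_def by (auto elim!: quotientE)

lemma S_val_nonempty: "V \<in> S_val \<Longrightarrow> V \<noteq> {}"
  using in_quotient_imp_non_empty[OF equiv_val_equiv_rel] by (simp add: S_val_def)

lemma class_ring_eq:
  assumes V: "V \<in> S_val" and v: "v \<in> V"
  shows "class_ring V = carrier (valuation_ring v)"
proof -
  have "vle u (vzero u) (val u a) \<longleftrightarrow> vle v (vzero v) (val v a)" if "u \<in> V" for u a
  proof -
    have "(v, u) \<in> val_equiv_rel"
      using quotient_eq_iff[OF equiv_val_equiv_rel, of V V v u] V v that by (simp add: S_val_def)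
    then have "val_equiv v u" by (simp add: val_equiv_rel_def)
    from val_equiv_vle_iff[OF S_val_krull_valuation[OF V v] this, of 1 a]
    show ?thesis
      using S_val_krull_valuation[OF V] v that by (simp add: krull_valuation.val_one)
  qed
  then have "class_ring V = {a. vle v (vzero v) (val v a)}"
    unfolding class_ring_def using v by blast
  then show ?thesis by (simp add: valuation_ring_def)
qed

lemma valuation_subring_class_ring: "V \<in> S_val \<Longrightarrow> valuation_subring (class_ring V)"
  using S_val_nonempty class_ring_eq S_val_krull_valuation krull_valuation.valuation_subring
  by (metis ex_in_conv)

text \<open>Through this, hypotheses about points of \<open>S_val\<close> apply to arbitrary
  valuation subrings. \<open>S_val_complete\<close> adjusts the type of the values.\<close>

lemma class_ring_surj:
  assumes "valuation_subring A"
  shows "\<exists>V\<in>S_val. class_ring V = A"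
proof -
  obtain w :: "('a, 'a) valuation" where w: "krull_valuation w"
    "\<And>a. vle w (vzero w) (val w a) \<longleftrightarrow> a \<in> A"
    using krull_valuation_of_subring[OF assms] by blast
  obtain V where V: "V \<in> S_val" "\<And>v. v \<in> V \<Longrightarrow> krull_valuation v \<and> val_equiv w v"
    using S_val_complete[OF w(1)] by blast
  obtain v where v: "v \<in> V" using S_val_nonempty[OF V(1)] by blast
  have "vle v (vzero v) (val v a) \<longleftrightarrow> a \<in> A" for a
    using val_equiv_vle_iff[OF w(1), of v 1 a] V(2)[OF v] w
    by (simp add: krull_valuation.val_one)
  then have "class_ring V = A" using class_ring_eq[OF V(1) v] by (simp add: valuation_ring_def)
  then show ?thesis using V(1) by blast
qed

section \<open>Closed sets of the Hochster dual\<close>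

text \<open>Zariski-open sets are closed under enlarging the valuation ring: subbasic sets are, and
  unions and intersections inherit it.\<close>

lemma zariski_separation:
  assumes "openin zariski C" "U \<in> C" "V \<notin> C" "V \<in> S_val"
  shows "\<exists>a. a \<in> class_ring U \<and> a \<notin> class_ring V"
proof -
  have "generate_topology_on (range (\<lambda>x. {V \<in> S_val. \<forall>v\<in>V. vle v (vzero v) (val v x)})) C"
    using assms(1) by (simp add: zariski_def openin_topology_generated_by_iff)
  then show ?thesis
    using assms(2,3)
  proof (induction rule: generate_topology_on.induct)
    case (Basis s)
    then show ?case using assms(4) by (auto simp: class_ring_def)
  qed auto
qed

lemma openin_zariski_class_ring: "openin zariski {V \<in> S_val. a \<in> class_ring V}"
  unfolding zariski_def
  by (rule topology_generated_by_Basis) (auto simp: class_ring_def)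

lemma topspace_zariski: "topspace zariski = (S_val :: ('a::field, 'a set) valuation set set)"
proof
  show "topspace zariski \<subseteq> (S_val :: ('a, 'a set) valuation set set)"
    unfolding zariski_def topology_generated_by_topspace by auto
  have "(0 :: 'a) \<in> class_ring V" if "V \<in> S_val" for V
    using valuation_subring_class_ring[OF that] field_subring.zero_mem
    by (auto simp: valuation_subring_def)
  then have "{V \<in> S_val. (0 :: 'a) \<in> class_ring V} = S_val" by blast
  then show "(S_val :: ('a, 'a set) valuation set set) \<subseteq> topspace zariski"
    using openin_subset[OF openin_zariski_class_ring[of "0 :: 'a"]] by simp
qed

text \<open>Complements of quasi-compact open sets form a basis and not only a subbasis, because the
  union of two quasi-compact open sets is again one.\<close>

lemma hochster_dual_separation:
  assumes "openin (hochster_dual T) W" "V \<in> W"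
  shows "\<exists>C. openin T C \<and> compactin T C \<and> V \<notin> C \<and> topspace T - C \<subseteq> W"
proof -
  have "generate_topology_on {topspace T - U | U. openin T U \<and> compactin T U} W"
    using assms(1) by (simp add: hochster_dual_def openin_topology_generated_by_iff)
  then show ?thesis
    using assms(2)
  proof (induction rule: generate_topology_on.induct)
    case (Int a b)
    then obtain C D where "openin T C" "compactin T C" "V \<notin> C" "topspace T - C \<subseteq> a"
      "openin T D" "compactin T D" "V \<notin> D" "topspace T - D \<subseteq> b" by auto
    then show ?case by (intro exI[of _ "C \<union> D"]) (auto intro: compactin_Un)
  next
    case (UN K)
    then obtain k where k: "k \<in> K" "V \<in> k" by (elim UnionE)
    obtain C where "openin T C" "compactin T C" "V \<notin> C" "topspace T - C \<subseteq> k"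
      using UN.IH[OF k] by auto
    then show ?case using k by (intro exI[of _ C]) auto
  qed auto
qed

text \<open>Separation gives a quasi-compact open \<open>C\<close> containing \<open>S\<close> but
  not \<open>V\<close>. The subbasic sets \<open>D a\<close> with \<open>a\<close> outside
  \<open>class_ring V\<close> cover \<open>C\<close>, and a finite subcover gives
  \<open>E\<close>.\<close>

lemma hochster_closed_cover:
  fixes V :: "('a::field, 'a set) valuation set"
  assumes S: "closedin (hochster_dual zariski) S" "S \<subseteq> S_val" and V: "V \<in> S_val" "V \<notin> S"
  shows "\<exists>E. finite E \<and> E \<inter> class_ring V = {} \<and> (\<forall>U\<in>S. E \<inter> class_ring U \<noteq> {})"
proof -
  \<comment> \<open>The empty set is quasi-compact and open, so all of \<open>S_val\<close> is open
    in the dual, and \<open>V\<close> is a point of that space.\<close>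
  have "openin (hochster_dual zariski) (topspace zariski - {})"
    unfolding hochster_dual_def by (rule topology_generated_by_Basis) auto
  then have "V \<in> topspace (hochster_dual zariski) - S"
    using V subsetD[OF openin_subset] by (simp add: topspace_zariski)
  moreover have "openin (hochster_dual zariski) (topspace (hochster_dual zariski) - S)"
    using S(1) by (simp add: closedin_def)
  ultimately obtain C where C: "openin zariski C" "compactin zariski C" "V \<notin> C"
    "topspace zariski - C \<subseteq> topspace (hochster_dual zariski) - S"
    using hochster_dual_separation[of zariski _ V] by meson
  then have SC: "S \<subseteq> C" using S(2) by (auto simp: topspace_zariski)
  define D :: "'a \<Rightarrow> ('a, 'a set) valuation set set" where "D a = {U \<in> S_val. a \<in> class_ring U}" for a
  have "C \<subseteq> \<Union> (D ` (- class_ring V))"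
    using zariski_separation[OF C(1) _ C(3) V(1)] openin_subset[OF C(1)]
    by (auto simp: D_def topspace_zariski)
  moreover have "\<forall>U \<in> D ` (- class_ring V). openin zariski U"
    by (simp add: D_def openin_zariski_class_ring)
  ultimately obtain \<F> where "finite \<F>" "\<F> \<subseteq> D ` (- class_ring V)" "C \<subseteq> \<Union>\<F>"
    using C(2) unfolding compactin_def by meson
  then obtain E where "finite E" "E \<subseteq> - class_ring V" "C \<subseteq> \<Union> (D ` E)"
    by (metis finite_subset_image)
  then show ?thesis using SC by (intro exI[of _ E]) (auto simp: D_def)
qed

text \<open>If \<open>V\<close> were missing, \<open>f\<close> would merge the finite set from
  \<open>hochster_closed_cover\<close> into one element of all rings of \<open>S\<close> outside
  that of \<open>V\<close>. As \<open>S\<close> is nonempty, so is the finite set, and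
  \<open>f\<close> is rootless over \<open>class_ring V\<close>.\<close>

lemma hochster_closed_contains:
  fixes f :: "'a::field poly"
  assumes S: "closedin (hochster_dual zariski) S" "S \<subseteq> S_val" "S \<noteq> {}"
    and f: "degree f > 0" "\<And>U. U \<in> S \<Longrightarrow> rootless_over f (class_ring U)"
    and V: "V \<in> S_val" "(\<Inter>U\<in>S. class_ring U) \<subseteq> class_ring V"
  shows "V \<in> S"
proof (rule ccontr)
  assume "V \<notin> S"
  then obtain E where E: "finite E" "E \<inter> class_ring V = {}" "\<And>U. U \<in> S \<Longrightarrow> E \<inter> class_ring U \<noteq> {}"
    using hochster_closed_cover[OF S(1,2) V(1)] by blast
  obtain c where c: "c \<notin> class_ring V" "\<And>A. A \<in> class_ring ` S \<Longrightarrow> E \<inter> A \<noteq> {} \<Longrightarrow> c \<in> A"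
  proof -
    have "\<exists>c. c \<notin> class_ring V \<and> (\<forall>A\<in>class_ring ` S. E \<inter> A \<noteq> {} \<longrightarrow> c \<in> A)"
    proof (rule rootless_over_finite)
      show "rootless_over f (class_ring V)"
        using rootless_over_mono[OF rootless_over_INT V(2)] S(3) f(2) by blast
      show "field_subring A \<and> rootless_over f A" if "A \<in> class_ring ` S" for A
        using that f(2) S(2) valuation_subring_class_ring valuation_subring.axioms(1) by blast
    qed (use E S f(1) valuation_subring_class_ring[OF V(1)] in auto)
    then show ?thesis using that by auto
  qed
  have "c \<in> class_ring U" if "U \<in> S" for U
    using c(2) E(3)[OF that] that by simp
  then show False using c(1) V(2) by auto
qed

section \<open>Approximation at the valuations of the sets \<open>S i\<close>\<close>

theorem theorem1p7:
  fixes n :: nat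
    and x z :: "nat \<Rightarrow> 'a::field"
    and S :: "nat \<Rightarrow> ('a, 'a set) valuation set set"
  assumes z_nonzero: "\<And>i. i \<in> {1..n} \<Longrightarrow> z i \<noteq> 0"
    and S_subset: "\<And>i. i \<in> {1..n} \<Longrightarrow> S i \<subseteq> S_val"
    and U: "\<exists>f :: 'a poly. degree f > 0 \<and> lead_coeff f = 1 \<and>
              (\<forall>V \<in> (\<Union>i\<in>{1..n}. S i). \<forall>v\<in>V.
                 (\<forall>k. coeff f k \<in> carrier (valuation_ring v)) \<and>
                 \<not> (\<exists>a \<in> carrier (residue_field v).
                      ring.eval (residue_field v) (reduction v f) a = \<zero>\<^bsub>residue_field v\<^esub>))"
    and T: "\<And>i. i \<in> {1..n} \<Longrightarrow> closedin (hochster_dual zariski) (S i)"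
    and I: "\<And>i j W w. \<lbrakk>i \<in> {1..n}; j \<in> {1..n}; W \<in> S i \<inter> S j; w \<in> W\<rbrakk>
              \<Longrightarrow> vle w (val w (z i)) (val w (x i - x j)) \<and> val w (z i) = val w (z j)"
  shows "\<exists>y :: 'a. \<forall>i \<in> {1..n}. \<forall>V \<in> S i. \<forall>v\<in>V. vle v (val v (z i)) (val v (y - x i))"
proof -
  from U obtain f :: "'a poly" where f: "degree f > 0" "lead_coeff f = 1"
    and root: "\<forall>V \<in> (\<Union>i\<in>{1..n}. S i). \<forall>v\<in>V.
      (\<forall>k. coeff f k \<in> carrier (valuation_ring v)) \<and>
      \<not> (\<exists>a \<in> carrier (residue_field v).
           ring.eval (residue_field v) (reduction v f) a = \<zero>\<^bsub>residue_field v\<^esub>)"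
    by (elim exE conjE)
  have S_val: "V \<in> S_val" if "i \<in> {1..n}" "V \<in> S i" for i V
    using S_subset that by blast
  have rootless: "rootless_over f (class_ring V)" if V: "i \<in> {1..n}" "V \<in> S i" for i V
  proof -
    obtain v where v: "v \<in> V" using S_val_nonempty[OF S_val[OF V]] by blast
    have "rootless_over f (carrier (valuation_ring v))"
      using S_val_krull_valuation[OF S_val[OF V] v] f(2) bspec[OF bspec[OF root UN_I[of i _ V S, OF V]] v]
      by (intro krull_valuation.rootless_over_valuation_ring) auto
    then show ?thesis using class_ring_eq[OF S_val[OF V] v] by simp
  qed
  have vle: "vle v (val v (z i)) (val v a) \<longleftrightarrow> a / z i \<in> class_ring V"
    if "i \<in> {1..n}" "V \<in> S i" "v \<in> V" for i V v a
    using krull_valuation.vle_iff_divide[OF S_val_krull_valuation[OF S_val] z_nonzero] that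
      class_ring_eq[OF S_val]
    by (simp add: valuation_ring_def)
  \<comment> \<open>Indices with empty \<open>S i\<close> impose no condition. They are set aside
    because \<open>hochster_closed_contains\<close> requires a nonempty set.\<close>
  define I' where "I' = {i \<in> {1..n}. S i \<noteq> {}}"
  define R where "R i = (\<Inter>V\<in>S i. class_ring V)" for i
  have "\<exists>y. \<forall>i\<in>I'. (y - x i) / z i \<in> R i"
  proof (rule approximation_by_localization[OF _ f(1)])
    show "finite I'" by (simp add: I'_def)
    show "field_subring (R i) \<and> rootless_over f (R i)" if "i \<in> I'" for i
      unfolding R_def
    proof (intro conjI field_subring_INT rootless_over_INT)
      show "S i \<noteq> {}" using that by (simp add: I'_def)
      fix V assume "V \<in> S i"
      then have V: "i \<in> {1..n}" "V \<in> S i" using that by (simp_all add: I'_def)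
      show "rootless_over f (class_ring V)" by (rule rootless[OF V])
      show "field_subring (class_ring V)"
        by (rule valuation_subring.axioms(1)[OF valuation_subring_class_ring[OF S_val[OF V]]])
    qed
    show "z i \<noteq> 0" if "i \<in> I'" for i using that z_nonzero by (simp add: I'_def)
    fix i j B assume ij: "i \<in> I'" "j \<in> I'" and B: "valuation_subring B" "R i \<subseteq> B" "R j \<subseteq> B"
    \<comment> \<open>The class \<open>W\<close> of the ring \<open>B\<close> lies in both
      \<open>S i\<close> and \<open>S j\<close> by (T), so (I) becomes available at
      \<open>W\<close>.\<close>
    obtain W where W: "W \<in> S_val" "class_ring W = B" using class_ring_surj[OF B(1)] by blast
    have WS: "W \<in> S k" if "k \<in> I'" "R k \<subseteq> B" for k
    proof -
      have k: "k \<in> {1..n}" "S k \<noteq> {}" using that by (simp_all add: I'_def)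
      show ?thesis
      proof (rule hochster_closed_contains[OF T[OF k(1)] S_subset[OF k(1)] k(2) f(1) _ W(1)])
        show "(\<Inter>V\<in>S k. class_ring V) \<subseteq> class_ring W" using that(2) by (simp add: R_def W(2))
      qed (rule rootless[OF k(1)])
    qed
    obtain w where w: "w \<in> W" using S_val_nonempty[OF W(1)] by blast
    have "(x i - x j) / z i \<in> B"
      using I[of i j W w] vle[of i W w] ij w WS B W(2) by (auto simp: I'_def)
    then have "- ((x i - x j) / z i) \<in> B"
      using B(1) by (intro field_subring.minus_mem valuation_subring.axioms(1))
    then show "(x j - x i) / z i \<in> B" by (simp add: minus_divide_left)
  qed
  then obtain y where "\<And>i. i \<in> I' \<Longrightarrow> (y - x i) / z i \<in> R i" by blast
  then have "vle v (val v (z i)) (val v (y - x i))" if "i \<in> {1..n}" "V \<in> S i" "v \<in> V" for i V v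
    using that vle by (auto simp: I'_def R_def)
  then show ?thesis by blast
qed

end
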